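(* Let $\alpha,\beta>0$ with $\alpha+\beta<\pi$ and put $c=\sin\alpha\sin\beta$. Let $v$ be the infimum of $\ell(\boldsymbol\gamma)$ over all continuous rectifiable paths $\boldsymbol\gamma:[0,1]\to\mathbb R^2$ with $\boldsymbol\gamma(0)=\mathbf 0$ and $F_{\boldsymbol\gamma}(t)\ge c$ for all $t\in[0,2\pi)$. For each integer $K\ge1$ let $v_K$ be the minimum of the length $\sum_{i=1}^K\|\mathbf q_i-\mathbf q_{i-1}\|$ over all polygonal paths $\mathbf 0=\mathbf q_0\to\mathbf q_1\to\cdots\to\mathbf q_K$ in $\mathbb R^2$ that satisfy $F(t)\ge c$ for all $t\in[0,2\pi)$. Then $$v_K\to v\qquad\text{as }K\to\infty .$$ Moreover, every sequence $(P_K)$ of asymptotically optimal polygonal paths of bounded length (i.e. $P_K$ is a polygonal path with vertices $\mathbf q_0=\mathbf 0,\mathbf q_1,\dots,\mathbf q_K$, satisfies the constraint $F_{P_K}(t)\ge c$ for all $t$, and $\ell(P_K)-v_K\to0$), parametrized with constant speed on $[0,1]$, has a uniformly convergent subsequence whose limit is an optimal continuous path, i.e. an admissible path of length $v$.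
   Context: $\ell$ denotes the length (total variation) of a path. For a continuous path $\boldsymbol\gamma:[0,1]\to\mathbb R^2$ with $\boldsymbol\gamma(0)=\mathbf 0$, its support function is $h_{\boldsymbol\gamma}(\phi)=\max_{p\in[0,1]}\boldsymbol\gamma(p)\cdot(\cos\phi,\sin\phi)$, and $$F_{\boldsymbol\gamma}(t)=\sin\beta\,h_{\boldsymbol\gamma}(t+\pi+\alpha)+\sin\alpha\,h_{\boldsymbol\gamma}(t+\pi-\beta)+\sin(\alpha+\beta)\,h_{\boldsymbol\gamma}(t).$$ For a polygonal path with vertices $\mathbf q_0=\mathbf 0,\mathbf q_1,\dots,\mathbf q_K$, the support function is $h_K(\phi)=\max_{0\le i\le K}\mathbf q_i\cdot(\cos\phi,\sin\phi)$, which agrees with the support function of the path as a continuous path, and $F$ is defined from it by the same formula. *)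

theory Defs
  imports "HOL-Analysis.Analysis"
begin

section \<open>Length of a path\<close>

definition partition_sums :: "(real \<Rightarrow> 'a::real_normed_vector) \<Rightarrow> real set" where
  "partition_sums \<gamma> =
     {\<Sum>i<n. norm (\<gamma> (t (Suc i)) - \<gamma> (t i)) | (n::nat) (t::nat \<Rightarrow> real).
        t 0 = 0 \<and> t n = 1 \<and> (\<forall>i<n. t i \<le> t (Suc i))}"

definition rectifiable :: "(real \<Rightarrow> 'a::real_normed_vector) \<Rightarrow> bool" where
  "rectifiable \<gamma> \<longleftrightarrow> bdd_above (partition_sums \<gamma>)"

definition path_len :: "(real \<Rightarrow> 'a::real_normed_vector) \<Rightarrow> real" where
  "path_len \<gamma> = Sup (partition_sums \<gamma>)"

section \<open>Support functions and the constraint\<close>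

definition dir :: "real \<Rightarrow> real ^ 2" where
  "dir \<phi> = vector [cos \<phi>, sin \<phi>]"

definition path_support :: "(real \<Rightarrow> real ^ 2) \<Rightarrow> real \<Rightarrow> real" where
  "path_support \<gamma> \<phi> = (SUP p\<in>{0..1}. \<gamma> p \<bullet> dir \<phi>)"

definition polygon_support :: "nat \<Rightarrow> (nat \<Rightarrow> real ^ 2) \<Rightarrow> real \<Rightarrow> real" where
  "polygon_support K q \<phi> = Max ((\<lambda>i. q i \<bullet> dir \<phi>) ` {0..K})"

definition F :: "real \<Rightarrow> real \<Rightarrow> (real \<Rightarrow> real) \<Rightarrow> real \<Rightarrow> real" where
  "F \<alpha> \<beta> h t = sin \<beta> * h (t + pi + \<alpha>) + sin \<alpha> * h (t + pi - \<beta>) + sin (\<alpha> + \<beta>) * h t"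

definition satisfies_constraint :: "real \<Rightarrow> real \<Rightarrow> (real \<Rightarrow> real) \<Rightarrow> bool" where
  "satisfies_constraint \<alpha> \<beta> h \<longleftrightarrow> (\<forall>t\<in>{0..<2 * pi}. F \<alpha> \<beta> h t \<ge> sin \<alpha> * sin \<beta>)"

section \<open>The continuous problem\<close>

definition admissible_path :: "real \<Rightarrow> real \<Rightarrow> (real \<Rightarrow> real ^ 2) \<Rightarrow> bool" where
  "admissible_path \<alpha> \<beta> \<gamma> \<longleftrightarrow>
     path \<gamma> \<and> rectifiable \<gamma> \<and> \<gamma> 0 = 0 \<and> satisfies_constraint \<alpha> \<beta> (path_support \<gamma>)"

definition path_value :: "real \<Rightarrow> real \<Rightarrow> real" where
  "path_value \<alpha> \<beta> = Inf {path_len \<gamma> | \<gamma>. admissible_path \<alpha> \<beta> \<gamma>}"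

section \<open>The polygonal problem\<close>

text \<open>A polygonal path with \<open>K\<close> edges is given by its vertices \<open>q 0, \<dots>, q K\<close>; the values
  of \<open>q\<close> beyond \<open>K\<close> are irrelevant.\<close>

definition polygon_len :: "nat \<Rightarrow> (nat \<Rightarrow> real ^ 2) \<Rightarrow> real" where
  "polygon_len K q = (\<Sum>i=1..K. norm (q i - q (i - 1)))"

definition admissible_polygon :: "real \<Rightarrow> real \<Rightarrow> nat \<Rightarrow> (nat \<Rightarrow> real ^ 2) \<Rightarrow> bool" where
  "admissible_polygon \<alpha> \<beta> K q \<longleftrightarrow>
     q 0 = 0 \<and> satisfies_constraint \<alpha> \<beta> (polygon_support K q)"

definition polygon_value :: "real \<Rightarrow> real \<Rightarrow> nat \<Rightarrow> real" where
  "polygon_value \<alpha> \<beta> K = Inf {polygon_len K q | q. admissible_polygon \<alpha> \<beta> K q}"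

text \<open>In the following, \<open>s i\<close> is the time at which the vertex \<open>q i\<close> is reached. Every edge is
  traversed affinely, with speed equal to the total length; edges of length zero take no time
  unless the whole path is constant.\<close>

definition constant_speed_param :: "nat \<Rightarrow> (nat \<Rightarrow> real ^ 2) \<Rightarrow> (real \<Rightarrow> real ^ 2) \<Rightarrow> bool" where
  "constant_speed_param K q \<gamma> \<longleftrightarrow>
     (\<exists>s :: nat \<Rightarrow> real. s 0 = 0 \<and> s K = 1 \<and>
        (\<forall>i<K. s i \<le> s (Suc i) \<and>
               norm (q (Suc i) - q i) = polygon_len K q * (s (Suc i) - s i) \<and>
               (\<forall>u\<in>{0..1}. \<gamma> (linepath (s i) (s (Suc i)) u) = linepath (q i) (q (Suc i)) u)))"

lemma polygon_len_Suc: "polygon_len (Suc i) q = polygon_len i q + norm (q (Suc i) - q i)"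
  by (simp add: polygon_len_def)

lemma ex_piecewise_linear:
  fixes s :: "nat \<Rightarrow> real" and q :: "nat \<Rightarrow> real ^ 2"
  assumes "\<And>i. i < K \<Longrightarrow> s i \<le> s (Suc i)"
    and "\<And>i. i < K \<Longrightarrow> s i = s (Suc i) \<Longrightarrow> q i = q (Suc i)"
  shows "\<exists>\<gamma>. \<gamma> (s K) = q K \<and>
    (\<forall>i<K. \<forall>u\<in>{0..1}. \<gamma> (linepath (s i) (s (Suc i)) u) = linepath (q i) (q (Suc i)) u)"
  using assms
proof (induction K)
  case 0
  show ?case by (intro exI[of _ "\<lambda>_. q 0"]) simp
next
  case (Suc K)
  then obtain \<gamma> where \<gamma>: "\<gamma> (s K) = q K"
    "\<And>i u. i < K \<Longrightarrow> u \<in> {0..1} \<Longrightarrow>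
       \<gamma> (linepath (s i) (s (Suc i)) u) = linepath (q i) (q (Suc i)) u"
    by (metis less_SucI)
  define \<delta> where "\<delta> = (\<lambda>x. if x \<le> s K then \<gamma> x
    else linepath (q K) (q (Suc K)) ((x - s K) / (s (Suc K) - s K)))"
  have le: "s i \<le> s K" if "i \<le> K" for i
    using that by (induction rule: inc_induct) (auto intro: order_trans[OF Suc.prems(1)])
  have lin: "linepath a b u = a + u * (b - a)" for a b u :: real
    by (simp add: linepath_def algebra_simps)
  have old: "\<delta> (linepath (s i) (s (Suc i)) u) = linepath (q i) (q (Suc i)) u"
    if "i < K" "u \<in> {0..1}" for i u
  proof -
    have "linepath (s i) (s (Suc i)) u \<le> s (Suc i)"
      using linepath_real_le_right[of "s i" "s (Suc i)" u] Suc.prems(1)[of i] that by auto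
    also have "\<dots> \<le> s K" using le that by simp
    finally show ?thesis using \<gamma> that by (simp add: \<delta>_def)
  qed
  have new: "\<delta> (linepath (s K) (s (Suc K)) u) = linepath (q K) (q (Suc K)) u"
    if u: "u \<in> {0..1}" for u
  proof (cases "s K = s (Suc K)")
    case True
    then have "q K = q (Suc K)" using Suc.prems(2) by simp
    then show ?thesis using \<gamma>(1) True by (simp add: \<delta>_def lin linepath_refl)
  next
    case False
    then have pos: "s K < s (Suc K)" using Suc.prems(1)[of K] by simp
    show ?thesis
    proof (cases "u = 0")
      case True
      then show ?thesis using \<gamma>(1) by (simp add: \<delta>_def linepath_def)
    next
      case False
      then have "0 < u * (s (Suc K) - s K)" using u pos by simp
      then have "\<not> linepath (s K) (s (Suc K)) u \<le> s K" by (simp add: lin)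
      then show ?thesis using pos by (simp add: \<delta>_def lin)
    qed
  qed
  have "\<delta> (s (Suc K)) = q (Suc K)"
    using new[of 1] by (simp add: linepath_def)
  with old new show ?case by (intro exI[of _ \<delta>]) (auto simp: less_Suc_eq)
qed

lemma ex_constant_speed_param:
  assumes "K \<ge> 1"
  shows "\<exists>\<gamma>. constant_speed_param K q \<gamma>"
proof -
  define L where "L = polygon_len K q"
  define s where "s = (\<lambda>i. if L = 0 then (if i = 0 then 0 else 1) else polygon_len i q / L)"
  have L0: "L \<ge> 0" unfolding L_def polygon_len_def by (simp add: sum_nonneg)
  have norm_eq: "norm (q (Suc i) - q i) = L * (s (Suc i) - s i)" if "i < K" for i
  proof (cases "L = 0")
    case True
    then have "\<forall>j\<in>{1..K}. norm (q j - q (j - 1)) = 0"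
      unfolding L_def polygon_len_def by (subst (asm) sum_nonneg_eq_0_iff) auto
    from bspec[OF this, of "Suc i"] that True show ?thesis by simp
  next
    case False
    then show ?thesis by (simp add: s_def polygon_len_Suc field_simps)
  qed
  have mono: "s i \<le> s (Suc i)" if "i < K" for i
    using L0 by (auto simp: s_def polygon_len_Suc divide_right_mono)
  have "s 0 = 0" "s K = 1" using assms by (auto simp: s_def polygon_len_def L_def)
  moreover have "q i = q (Suc i)" if "i < K" "s i = s (Suc i)" for i
    using norm_eq[OF that(1)] that(2) by simp
  ultimately show ?thesis
    using ex_piecewise_linear[of K s q] mono norm_eq
    unfolding constant_speed_param_def L_def by blast
qed

end

theory Submission
  imports Defs "HOL-Complex_Analysis.Great_Picard"
begin

text \<open>Since the constraint level \<open>sin \<alpha> * sin \<beta>\<close> is positive and the constraint is homogeneous in the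
  path, a small uniform violation of the constraint is repaired by a dilation with factor close
  to 1. Applied to the polygons inscribed in a nearly optimal path, this gives
  \<open>limsup v\<^sub>K \<le> v\<close>; conversely a polygon traversed at constant speed is an admissible path.
  Constant speed parametrizations are equi-Lipschitz, so a subsequence converges uniformly by
  Arzela-Ascoli; the constraint is closed and the length lower semicontinuous under such limits.\<close>

section \<open>Support functions\<close>

lemma norm_dir [simp]: "norm (dir \<phi>) = 1"
  by (simp add: dir_def norm_eq_sqrt_inner inner_vec_def sum_2 flip: power2_eq_square)

lemma inner_dir_le_dist: "x \<bullet> dir \<phi> \<le> y \<bullet> dir \<phi> + dist x y"
  using norm_cauchy_schwarz[of "x - y" "dir \<phi>"] by (simp add: inner_diff_left dist_norm)

lemma polygon_support_ge: "i \<le> K \<Longrightarrow> q i \<bullet> dir \<phi> \<le> polygon_support K q \<phi>"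
  unfolding polygon_support_def by (intro Max_ge) auto

lemma polygon_support_attained:
  obtains i where "i \<le> K" "polygon_support K q \<phi> = q i \<bullet> dir \<phi>"
proof -
  have "polygon_support K q \<phi> \<in> (\<lambda>i. q i \<bullet> dir \<phi>) ` {0..K}"
    unfolding polygon_support_def by (intro Max_in) auto
  then show thesis using that by auto
qed

lemma polygon_support_Suc:
  "polygon_support (Suc K) q \<phi> = max (q (Suc K) \<bullet> dir \<phi>) (polygon_support K q \<phi>)"
  unfolding polygon_support_def by (simp add: atLeast0_atMost_Suc)

text \<open>Continuity is with respect to the product topology on vertex sequences. It makes the
  constraint at each fixed angle a closed condition on \<open>q\<close>. Adding one vertex takes one
  more maximum.\<close>

lemma continuous_on_polygon_support: "continuous_on UNIV (\<lambda>q. polygon_support K q \<phi>)"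
proof (induction K)
  case 0
  show ?case by (simp add: polygon_support_def continuous_intros)
next
  case (Suc K)
  then show ?case
    unfolding polygon_support_Suc by (intro continuous_on_max continuous_intros) auto
qed

lemma path_support_ge:
  assumes "path \<gamma>" "p \<in> {0..1}"
  shows "\<gamma> p \<bullet> dir \<phi> \<le> path_support \<gamma> \<phi>"
proof -
  have "compact ((\<lambda>p. \<gamma> p \<bullet> dir \<phi>) ` {0..1})"
    using assms(1) by (intro compact_continuous_image continuous_intros) (auto simp: path_def)
  then have "bdd_above ((\<lambda>p. \<gamma> p \<bullet> dir \<phi>) ` {0..1})"
    by (intro bounded_imp_bdd_above compact_imp_bounded)
  then show ?thesis
    unfolding path_support_def using assms(2) by (intro cSUP_upper)
qed

lemma path_support_le:
  assumes "\<And>p. p \<in> {0..1} \<Longrightarrow> \<gamma> p \<bullet> dir \<phi> \<le> b"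
  shows "path_support \<gamma> \<phi> \<le> b"
  unfolding path_support_def using assms by (intro cSUP_least) auto

text \<open>Directions are unit vectors, so the support function is 1-Lipschitz in the sup distance
  of paths, uniformly in the angle.\<close>

lemma path_support_le_add:
  assumes "path \<gamma>'" "\<And>p. p \<in> {0..1} \<Longrightarrow> dist (\<gamma> p) (\<gamma>' p) \<le> d"
  shows "path_support \<gamma> \<phi> \<le> path_support \<gamma>' \<phi> + d"
proof (rule path_support_le)
  fix p :: real assume p: "p \<in> {0..1}"
  show "\<gamma> p \<bullet> dir \<phi> \<le> path_support \<gamma>' \<phi> + d"
    using inner_dir_le_dist[of "\<gamma> p" \<phi> "\<gamma>' p"] path_support_ge[OF assms(1) p, of \<phi>] assms(2)[OF p]
    by linarith
qed

lemma F_scale: "F \<alpha> \<beta> (\<lambda>\<phi>. l * h \<phi>) t = l * F \<alpha> \<beta> h t"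
  by (simp add: F_def algebra_simps)

section \<open>Lengths\<close>

lemma polygon_len_lessThan: "polygon_len K q = (\<Sum>i<K. norm (q (Suc i) - q i))"
  by (induction K) (simp_all add: polygon_len_Suc, simp add: polygon_len_def)

lemma polygon_len_nonneg: "0 \<le> polygon_len K q"
  by (simp add: polygon_len_def sum_nonneg)

lemma norm_vertex_le_polygon_len:
  assumes "q 0 = 0" "i \<le> K"
  shows "norm (q i) \<le> polygon_len K q"
proof -
  have "norm (q i) \<le> polygon_len i q"
  proof (induction i)
    case 0
    then show ?case using assms(1) by (simp add: polygon_len_nonneg)
  next
    case (Suc i)
    then show ?case
      using norm_triangle_ineq[of "q i" "q (Suc i) - q i"] by (simp add: polygon_len_Suc)
  qed
  also have "polygon_len i q \<le> polygon_len K q"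
    unfolding polygon_len_def using assms(2) by (intro sum_mono2) auto
  finally show ?thesis .
qed

lemma polygon_len_scaleR: "0 \<le> l \<Longrightarrow> polygon_len K (\<lambda>i. l *\<^sub>R q i) = l * polygon_len K q"
  by (simp add: polygon_len_def sum_distrib_left flip: scaleR_diff_right)

lemma continuous_on_polygon_len: "continuous_on UNIV (polygon_len K)"
  unfolding polygon_len_def by (intro continuous_intros) auto

section \<open>Partition sums and the length of Lipschitz paths\<close>

lemma partition_point_in_unit:
  fixes t :: "nat \<Rightarrow> real"
  assumes "t 0 = 0" "t n = 1" "\<And>i. i < n \<Longrightarrow> t i \<le> t (Suc i)" "i \<le> n"
  shows "t i \<in> {0..1}"
proof -
  have "t 0 \<le> t i" using assms(4)
    by (induction i) (auto intro: order_trans[OF _ assms(3)])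
  moreover have "t i \<le> t n" using assms(4)
    by (induction rule: inc_induct) (auto intro: order_trans[OF assms(3)])
  ultimately show ?thesis using assms(1,2) by simp
qed

lemma partition_sums_nonempty: "partition_sums \<gamma> \<noteq> {}"
proof -
  \<comment> \<open>The witness is the trivial partition with one interval: \<open>real\<close> maps
    the indices 0 and 1 to the endpoints.\<close>
  have "norm (\<gamma> 1 - \<gamma> 0) \<in> partition_sums \<gamma>"
    unfolding partition_sums_def by (rule CollectI, rule exI[of _ 1], rule exI[of _ real]) simp
  then show ?thesis by blast
qed

lemma path_len_nonneg:
  assumes "rectifiable \<gamma>"
  shows "0 \<le> path_len \<gamma>"
proof -
  obtain x where x: "x \<in> partition_sums \<gamma>" using partition_sums_nonempty by blast
  then have "0 \<le> x" by (auto simp: partition_sums_def intro: sum_nonneg)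
  also have "x \<le> path_len \<gamma>"
    unfolding path_len_def using assms x by (intro cSup_upper) (auto simp: rectifiable_def)
  finally show ?thesis .
qed

text \<open>Each increment is at most \<open>L\<close> times the step of the partition, and the
  steps telescope to 1. All upper bounds on \<open>path_len\<close> for polygonal paths and for the
  limit path come from here.\<close>

lemma partition_sum_le_lipschitz:
  assumes "L-lipschitz_on {0..1} \<gamma>" "x \<in> partition_sums \<gamma>"
  shows "x \<le> L"
proof -
  obtain n t where t: "t 0 = 0" "t n = 1" "\<And>i. i < n \<Longrightarrow> t i \<le> t (Suc i)"
    and x: "x = (\<Sum>i<n. norm (\<gamma> (t (Suc i)) - \<gamma> (t i)))"
    using assms(2) by (auto simp: partition_sums_def)
  have "x \<le> (\<Sum>i<n. L * (t (Suc i) - t i))"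
    unfolding x
  proof (rule sum_mono)
    fix i assume "i \<in> {..<n}"
    then show "norm (\<gamma> (t (Suc i)) - \<gamma> (t i)) \<le> L * (t (Suc i) - t i)"
      using lipschitz_onD[OF assms(1), of "t (Suc i)" "t i"] t(3)[of i]
        partition_point_in_unit[OF t, of i] partition_point_in_unit[OF t, of "Suc i"]
      by (auto simp: dist_norm)
  qed
  also have "\<dots> = L" using t(1,2) by (simp add: sum_lessThan_telescope flip: sum_distrib_left)
  finally show ?thesis .
qed

lemma lipschitz_imp_rectifiable: "L-lipschitz_on {0..1} \<gamma> \<Longrightarrow> rectifiable \<gamma>"
  unfolding rectifiable_def by (meson bdd_aboveI partition_sum_le_lipschitz)

lemma path_len_le_lipschitz: "L-lipschitz_on {0..1} \<gamma> \<Longrightarrow> path_len \<gamma> \<le> L"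
  unfolding path_len_def by (intro cSup_least partition_sums_nonempty) (rule partition_sum_le_lipschitz)

section \<open>Constant speed parametrizations\<close>

lemma constant_speed_param_vertex:
  assumes "constant_speed_param K q \<gamma>" "K \<ge> 1" "i \<le> K"
  obtains p where "p \<in> {0..1}" "\<gamma> p = q i"
proof -
  obtain s where s: "s 0 = 0" "s K = 1" "\<And>i. i < K \<Longrightarrow> s i \<le> s (Suc i)"
    and \<gamma>: "\<And>i u. i < K \<Longrightarrow> u \<in> {0..1} \<Longrightarrow>
      \<gamma> (linepath (s i) (s (Suc i)) u) = linepath (q i) (q (Suc i)) u"
    using assms(1) by (auto simp: constant_speed_param_def)
  have "\<gamma> (s i) = q i"
  proof (cases "i < K")
    case True
    then show ?thesis using \<gamma>[of i 0] by (simp add: linepath_def)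
  next
    \<comment> \<open>The last vertex starts no edge, so it is reached as the end of edge
      \<open>K - 1\<close>; this is where \<open>K \<ge> 1\<close> enters.\<close>
    case False
    then show ?thesis using \<gamma>[of "K - 1" 1] assms(2,3) by (simp add: linepath_def)
  qed
  then show thesis using that partition_point_in_unit[OF s assms(3)] by blast
qed

lemma constant_speed_param_lipschitz:
  assumes "constant_speed_param K q \<gamma>"
  shows "(polygon_len K q)-lipschitz_on {0..1} \<gamma>"
proof -
  define L where "L = polygon_len K q"
  have L: "0 \<le> L" by (simp add: L_def polygon_len_nonneg)
  obtain s where s: "s 0 = 0" "s K = 1" "\<And>i. i < K \<Longrightarrow> s i \<le> s (Suc i)"
    and speed: "\<And>i. i < K \<Longrightarrow> norm (q (Suc i) - q i) = L * (s (Suc i) - s i)"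
    and \<gamma>: "\<And>i u. i < K \<Longrightarrow> u \<in> {0..1} \<Longrightarrow>
      \<gamma> (linepath (s i) (s (Suc i)) u) = linepath (q i) (q (Suc i)) u"
    using assms by (auto simp: constant_speed_param_def L_def)
  have edge: "L-lipschitz_on {s i..s (Suc i)} \<gamma>" if i: "i < K" for i
  proof (rule lipschitz_onI)
    fix x y assume xy: "x \<in> {s i..s (Suc i)}" "y \<in> {s i..s (Suc i)}"
    have seg: "closed_segment (s i) (s (Suc i)) = {s i..s (Suc i)}"
      using s(3)[OF i] by (simp add: closed_segment_eq_real_ivl)
    obtain u where u: "u \<in> {0..1}" "x = linepath (s i) (s (Suc i)) u"
      using xy(1) unfolding seg[symmetric] linepath_image_01[symmetric] by blast
    obtain w where w: "w \<in> {0..1}" "y = linepath (s i) (s (Suc i)) w"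
      using xy(2) unfolding seg[symmetric] linepath_image_01[symmetric] by blast
    \<comment> \<open>Stated for an arbitrary normed space so that it applies both to the times
      \<open>s i\<close> and to the vertices \<open>q i\<close>.\<close>
    have diff: "linepath a b u - linepath a b w = (u - w) *\<^sub>R (b - a)"
      for a b :: "'b::real_normed_vector"
      by (simp add: linepath_def algebra_simps)
    have "dist (\<gamma> x) (\<gamma> y) = \<bar>u - w\<bar> * norm (q (Suc i) - q i)"
      using \<gamma>[OF i] u w diff[of "q i" "q (Suc i)"] by (simp add: dist_norm)
    also have "\<dots> = L * \<bar>x - y\<bar>"
      using speed[OF i] s(3)[OF i] u w diff[of "s i" "s (Suc i)"] by (simp add: abs_mult)
    finally show "dist (\<gamma> x) (\<gamma> y) \<le> L * dist x y" by (simp add: dist_real_def)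
  qed (rule L)
  \<comment> \<open>The edges are glued one at a time. The index set \<open>{0, 1}\<close> presents
    the old interval and the new edge as a finite family of closed sets, and the constant
    \<open>L\<close> does not grow.\<close>
  have "L-lipschitz_on {s 0..s j} \<gamma>" if "j \<le> K" for j
    using that
  proof (induction j)
    case 0
    then show ?case using L by (auto intro: lipschitz_onI)
  next
    case (Suc j)
    have "{s 0..s (Suc j)} \<subseteq> (\<Union>i\<in>{0, 1::nat}. if i = 0 then {s 0..s j} else {s j..s (Suc j)})"
      by auto
    then show ?case
      using Suc edge[of j] L
      by (intro lipschitz_on_closed_Union
          [of "{0, 1::nat}" _ "\<lambda>i. if i = 0 then {s 0..s j} else {s j..s (Suc j)}"])
        (auto split: if_splits)
  qed
  from this[of K] show ?thesis using s by (simp add: L_def)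
qed

lemma constant_speed_param_start:
  assumes "constant_speed_param K q \<gamma>" "K \<ge> 1"
  shows "\<gamma> 0 = q 0"
proof -
  obtain s where "s 0 = (0::real)" "\<gamma> (linepath (s 0) (s (Suc 0)) 0) = linepath (q 0) (q (Suc 0)) 0"
    using assms unfolding constant_speed_param_def
    by (metis One_nat_def Suc_le_eq atLeastAtMost_iff order_refl zero_le_one)
  then show ?thesis by (simp add: linepath_def)
qed

section \<open>The constraint\<close>

locale triangle_angles =
  fixes \<alpha> \<beta> :: real
  assumes angles: "0 < \<alpha>" "0 < \<beta>" "\<alpha> + \<beta> < pi"
begin

lemma sin_pos: "0 < sin \<alpha>" "0 < sin \<beta>" "0 < sin (\<alpha> + \<beta>)"
  using angles by (auto intro!: sin_gt_zero)

definition c :: real where "c = sin \<alpha> * sin \<beta>"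

text \<open>The total weight in \<open>F\<close>, hence its Lipschitz constant under uniform changes
  of the support function.\<close>

definition W :: real where "W = sin \<alpha> + sin \<beta> + sin (\<alpha> + \<beta>)"

lemma c_pos: "0 < c" and W_pos: "0 < W"
  using sin_pos by (simp_all add: c_def W_def)

text \<open>The weights are positive, so \<open>F\<close> is monotone in \<open>h\<close>, and
  shifting \<open>h\<close> by the constant \<open>d\<close> shifts \<open>F\<close> by
  \<open>W * d\<close>.\<close>

lemma F_le_add:
  assumes "\<And>\<phi>. h \<phi> \<le> h' \<phi> + d"
  shows "F \<alpha> \<beta> h t \<le> F \<alpha> \<beta> h' t + W * d"
proof -
  have "F \<alpha> \<beta> h t \<le> F \<alpha> \<beta> (\<lambda>\<phi>. h' \<phi> + d) t"
    unfolding F_def using sin_pos assms by (intro add_mono mult_left_mono) auto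
  then show ?thesis by (simp add: F_def W_def algebra_simps)
qed

lemma F_mono: "(\<And>\<phi>. h \<phi> \<le> h' \<phi>) \<Longrightarrow> F \<alpha> \<beta> h t \<le> F \<alpha> \<beta> h' t"
  using F_le_add[of h h' 0] by simp

lemma satisfies_constraint_mono:
  "satisfies_constraint \<alpha> \<beta> h \<Longrightarrow> (\<And>\<phi>. h \<phi> \<le> h' \<phi>) \<Longrightarrow> satisfies_constraint \<alpha> \<beta> h'"
  unfolding satisfies_constraint_def by (meson F_mono order_trans)

text \<open>This is the repair by dilation: both the support function and \<open>F\<close> are
  positively homogeneous, so a factor \<open>l\<close> lifts a lower bound \<open>c / l\<close> on
  \<open>F\<close> to \<open>c\<close>.\<close>

lemma admissible_polygon_scaleR:
  assumes "q 0 = 0" "0 \<le> l" "\<And>t. c \<le> l * F \<alpha> \<beta> (polygon_support K q) t"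
  shows "admissible_polygon \<alpha> \<beta> K (\<lambda>i. l *\<^sub>R q i)"
proof -
  have "l * polygon_support K q \<phi> \<le> polygon_support K (\<lambda>i. l *\<^sub>R q i) \<phi>" for \<phi>
  proof -
    obtain i where "i \<le> K" "polygon_support K q \<phi> = q i \<bullet> dir \<phi>"
      by (rule polygon_support_attained)
    then show ?thesis
      using polygon_support_ge[of i K "\<lambda>i. l *\<^sub>R q i" \<phi>] by simp
  qed
  from satisfies_constraint_mono[OF _ this] show ?thesis
    using assms by (simp add: admissible_polygon_def satisfies_constraint_def F_scale c_def)
qed

section \<open>Polygonal minimizers\<close>

text \<open>The three directions in \<open>F\<close>, taken with their weights, sum to zero, so on a segment \<open>F\<close> is half
  the weighted sum of the absolute values of the three inner products.\<close>

lemma F_segment_ge: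
  assumes "\<And>\<phi>. max 0 (cos \<phi>) \<le> h \<phi>"
  shows "min (sin \<beta>) (sin (\<alpha> + \<beta>)) * sin \<alpha> / 4 \<le> F \<alpha> \<beta> h t"
proof -
  define w where "w = min (sin \<beta>) (sin (\<alpha> + \<beta>))"
  define x where "x = cos (t + pi + \<alpha>)"
  define y where "y = cos (t + pi - \<beta>)"
  define z where "z = cos t"
  have w: "0 < w" "w \<le> sin \<beta>" "w \<le> sin (\<alpha> + \<beta>)" using sin_pos by (auto simp: w_def)
  \<comment> \<open>By the law of sines the three weights are the sides of a triangle with edges in
    the three directions, so the weighted directions close up.\<close>
  have zero: "sin \<beta> * x + sin \<alpha> * y + sin (\<alpha> + \<beta>) * z = 0"
    by (simp add: x_def y_def z_def cos_add cos_diff sin_add sin_diff algebra_simps)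
  have max_abs: "max 0 a = (a + \<bar>a\<bar>) / 2" for a :: real by (simp add: max_def)
  have x': "x = sin t * sin \<alpha> - cos t * cos \<alpha>"
    by (simp add: x_def cos_add sin_add)
  \<comment> \<open>\<open>x\<close> and \<open>z\<close> cannot both be small, because their
    directions are independent. Bounding \<open>sin t * sin \<alpha>\<close> and
    \<open>cos t * sin \<alpha>\<close> by \<open>x\<close> and \<open>z\<close> and using that
    \<open>\<bar>sin t\<bar> + \<bar>cos t\<bar>\<close> is at least 1 makes this
    quantitative.\<close>
  have "\<bar>sin t * sin \<alpha>\<bar> \<le> \<bar>x\<bar> + \<bar>z\<bar>"
  proof -
    have "\<bar>sin t * sin \<alpha>\<bar> = \<bar>x + z * cos \<alpha>\<bar>" by (simp add: x' z_def)
    also have "\<dots> \<le> \<bar>x\<bar> + \<bar>z\<bar> * \<bar>cos \<alpha>\<bar>" by (metis abs_mult abs_triangle_ineq)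
    also have "\<bar>z\<bar> * \<bar>cos \<alpha>\<bar> \<le> \<bar>z\<bar>" by (simp add: mult_left_le)
    finally show ?thesis by simp
  qed
  moreover have "\<bar>cos t * sin \<alpha>\<bar> \<le> \<bar>z\<bar>" by (simp add: z_def abs_mult mult_left_le)
  moreover have "1 \<le> \<bar>sin t\<bar> + \<bar>cos t\<bar>"
  proof -
    have "1 = (sin t)\<^sup>2 + (cos t)\<^sup>2" by simp
    also have "\<dots> \<le> \<bar>sin t\<bar> + \<bar>cos t\<bar>"
      by (intro add_mono) (metis abs_ge_zero abs_sin_le_one abs_cos_le_one mult_left_le power2_abs power2_eq_square)+
    finally show ?thesis .
  qed
  then have "sin \<alpha> \<le> \<bar>sin t * sin \<alpha>\<bar> + \<bar>cos t * sin \<alpha>\<bar>"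
    using mult_right_mono[of 1 "\<bar>sin t\<bar> + \<bar>cos t\<bar>" "sin \<alpha>"] sin_pos(1) by (simp add: abs_mult algebra_simps)
  ultimately have "sin \<alpha> / 2 \<le> \<bar>x\<bar> + \<bar>z\<bar>" by linarith
  then have "w * (sin \<alpha> / 2) \<le> w * (\<bar>x\<bar> + \<bar>z\<bar>)"
    by (rule mult_left_mono) (use w in simp)
  also have "\<dots> \<le> sin \<beta> * \<bar>x\<bar> + sin (\<alpha> + \<beta>) * \<bar>z\<bar> + sin \<alpha> * \<bar>y\<bar>"
    using mult_right_mono[OF w(2) abs_ge_zero[of x]] mult_right_mono[OF w(3) abs_ge_zero[of z]]
      mult_nonneg_nonneg[OF less_imp_le[OF sin_pos(1)] abs_ge_zero[of y]]
    unfolding distrib_left by linarith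
  also have "\<dots> = 2 * F \<alpha> \<beta> (\<lambda>\<phi>. max 0 (cos \<phi>)) t"
  proof -
    have "2 * F \<alpha> \<beta> (\<lambda>\<phi>. max 0 (cos \<phi>)) t =
        sin \<beta> * (x + \<bar>x\<bar>) + sin \<alpha> * (y + \<bar>y\<bar>) + sin (\<alpha> + \<beta>) * (z + \<bar>z\<bar>)"
      by (simp add: F_def max_abs x_def y_def z_def)
    then show ?thesis using zero by (simp add: distrib_left)
  qed
  also have "\<dots> \<le> 2 * F \<alpha> \<beta> h t" using F_mono[OF assms] by simp
  finally show ?thesis by (simp add: w_def)
qed

text \<open>The segment from 0 to (1, 0), with all later vertices repeating its end, has
  \<open>F\<close> at least \<open>m > 0\<close>; dilating it by \<open>c / m\<close> reaches the
  level \<open>c\<close>.\<close>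

lemma ex_admissible_polygon:
  assumes "K \<ge> 1"
  shows "\<exists>q. admissible_polygon \<alpha> \<beta> K q"
proof -
  define q :: "nat \<Rightarrow> real ^ 2" where "q = (\<lambda>i. if i = 0 then 0 else vector [1, 0])"
  define m where "m = min (sin \<beta>) (sin (\<alpha> + \<beta>)) * sin \<alpha> / 4"
  have m: "0 < m" using sin_pos by (simp add: m_def)
  have "vector [1, 0] \<bullet> dir \<phi> = cos \<phi>" for \<phi>
    by (simp add: dir_def inner_vec_def sum_2)
  then have "max 0 (cos \<phi>) \<le> polygon_support K q \<phi>" for \<phi>
    using polygon_support_ge[of 0 K q \<phi>] polygon_support_ge[of 1 K q \<phi>] assms by (simp add: q_def)
  from F_segment_ge[OF this] have "m \<le> F \<alpha> \<beta> (polygon_support K q) t" for t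
    by (simp add: m_def)
  then have "c / m * m \<le> c / m * F \<alpha> \<beta> (polygon_support K q) t" for t
    using m c_pos by (intro mult_left_mono) auto
  then have "admissible_polygon \<alpha> \<beta> K (\<lambda>i. (c / m) *\<^sub>R q i)"
    using m c_pos by (intro admissible_polygon_scaleR) (auto simp: q_def)
  then show ?thesis by blast
qed

lemma polygon_value_le: "admissible_polygon \<alpha> \<beta> K q \<Longrightarrow> polygon_value \<alpha> \<beta> K \<le> polygon_len K q"
  unfolding polygon_value_def
  by (rule cInf_lower) (auto intro!: bdd_belowI[of _ 0] simp: polygon_len_nonneg)

text \<open>Direct method: polygons no longer than a fixed admissible one \<open>q\<^sub>0\<close>
  have all vertices in a ball, because they start at 0, and a continuous length attains its minimum
  on the resulting compact set.\<close>

lemma polygon_value_attained: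
  assumes "K \<ge> 1"
  obtains q where "admissible_polygon \<alpha> \<beta> K q" "polygon_len K q = polygon_value \<alpha> \<beta> K"
proof -
  obtain q\<^sub>0 where q\<^sub>0: "admissible_polygon \<alpha> \<beta> K q\<^sub>0" using ex_admissible_polygon[OF assms] ..
  define M where "M = polygon_len K q\<^sub>0"
  define B where "B = (UNIV :: nat set) \<rightarrow>\<^sub>E cball (0 :: real ^ 2) M"
  define S where "S = B \<inter> {q. admissible_polygon \<alpha> \<beta> K q}"
  text \<open>Vertices beyond \<open>K\<close> are unconstrained, so they are reset to 0 to land in the compact box \<open>B\<close>.\<close>
  define cut where "cut = (\<lambda>(q :: nat \<Rightarrow> real ^ 2) i. if i \<le> K then q i else 0)"
  have cut_len: "polygon_len K (cut q) = polygon_len K q" for q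
    unfolding polygon_len_def by (rule sum.cong) (auto simp: cut_def)
  have "polygon_support K (cut q) = polygon_support K q" for q
    unfolding polygon_support_def by (rule ext, rule arg_cong[where f = Max]) (auto simp: cut_def)
  then have cut_adm: "admissible_polygon \<alpha> \<beta> K (cut q)" if "admissible_polygon \<alpha> \<beta> K q" for q
    using that by (simp add: admissible_polygon_def cut_def)
  have cut_S: "cut q \<in> S" if q: "admissible_polygon \<alpha> \<beta> K q" "polygon_len K q \<le> M" for q
  proof -
    have "norm (cut q i) \<le> M" for i
      using norm_vertex_le_polygon_len[of q i K] q norm_vertex_le_polygon_len[of q 0 K]
      by (auto simp: cut_def admissible_polygon_def)
    then show ?thesis using cut_adm[OF q(1)] by (auto simp: S_def B_def)
  qed
  \<comment> \<open>Polygons are sequences indexed by all naturals, so compactness of the box is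
    Tychonoff's theorem.\<close>
  have "compactin (product_topology (\<lambda>_. euclidean) UNIV) B"
    unfolding B_def compactin_PiE by simp
  then have "compact B" by (simp add: euclidean_product_topology)
  moreover have "closed {q. admissible_polygon \<alpha> \<beta> K q}"
    unfolding admissible_polygon_def satisfies_constraint_def F_def Ball_def
    by (intro closed_Collect_conj closed_Collect_all closed_Collect_imp open_Collect_const
        closed_Collect_le closed_Collect_eq continuous_intros continuous_on_polygon_support
        continuous_on_product_coordinates)
  ultimately have "compact S" unfolding S_def by (rule compact_Int_closed)
  moreover have "S \<noteq> {}" using cut_S[OF q\<^sub>0] by (auto simp: M_def)
  ultimately obtain q where q: "q \<in> S" "\<And>p. p \<in> S \<Longrightarrow> polygon_len K q \<le> polygon_len K p"
    using continuous_attains_inf continuous_on_subset[OF continuous_on_polygon_len]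
    by (metis subset_UNIV)
  \<comment> \<open>Competitors longer than \<open>M\<close> lie outside the compact set, but they
    already lose to \<open>q\<^sub>0\<close>.\<close>
  have "polygon_len K q \<le> polygon_len K p" if p: "admissible_polygon \<alpha> \<beta> K p" for p
  proof (cases "polygon_len K p \<le> M")
    case True
    then show ?thesis using q(2)[OF cut_S[OF p]] cut_len by simp
  next
    case False
    moreover have "polygon_len K q \<le> M"
      using q(2)[OF cut_S[OF q\<^sub>0]] cut_len by (simp add: M_def)
    ultimately show ?thesis by simp
  qed
  moreover have adm: "admissible_polygon \<alpha> \<beta> K q" using q(1) by (simp add: S_def)
  ultimately have "polygon_len K q = polygon_value \<alpha> \<beta> K"
    using polygon_value_le[OF adm] unfolding polygon_value_def
    by (intro antisym cInf_greatest) auto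
  then show thesis using that adm by blast
qed

section \<open>Convergence of the values\<close>

lemma path_value_le: "admissible_path \<alpha> \<beta> \<gamma> \<Longrightarrow> path_value \<alpha> \<beta> \<le> path_len \<gamma>"
  unfolding path_value_def
  by (rule cInf_lower) (auto intro!: bdd_belowI[of _ 0] path_len_nonneg simp: admissible_path_def)

lemma constant_speed_param_admissible:
  assumes "admissible_polygon \<alpha> \<beta> K q" "constant_speed_param K q \<gamma>" "K \<ge> 1"
  shows "admissible_path \<alpha> \<beta> \<gamma>"
proof -
  have lip: "(polygon_len K q)-lipschitz_on {0..1} \<gamma>"
    by (rule constant_speed_param_lipschitz[OF assms(2)])
  have path: "path \<gamma>" unfolding path_def by (rule lipschitz_on_continuous_on[OF lip])
  \<comment> \<open>Every vertex lies on the path, so the path has the larger support function, and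
    the constraint is monotone in it.\<close>
  have "polygon_support K q \<phi> \<le> path_support \<gamma> \<phi>" for \<phi>
  proof -
    obtain i where i: "i \<le> K" "polygon_support K q \<phi> = q i \<bullet> dir \<phi>"
      by (rule polygon_support_attained)
    obtain p where "p \<in> {0..1}" "\<gamma> p = q i"
      by (rule constant_speed_param_vertex[OF assms(2,3) i(1)])
    then show ?thesis using path_support_ge[OF path, of p \<phi>] i(2) by simp
  qed
  then show ?thesis
    using assms path lipschitz_imp_rectifiable[OF lip] constant_speed_param_start[OF assms(2,3)]
    by (auto simp: admissible_path_def admissible_polygon_def intro: satisfies_constraint_mono)
qed

lemma path_value_le_polygon_value:
  assumes "K \<ge> 1"
  shows "path_value \<alpha> \<beta> \<le> polygon_value \<alpha> \<beta> K"
proof -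
  obtain q where q: "admissible_polygon \<alpha> \<beta> K q" "polygon_len K q = polygon_value \<alpha> \<beta> K"
    by (rule polygon_value_attained[OF assms])
  obtain \<gamma> where \<gamma>: "constant_speed_param K q \<gamma>" using ex_constant_speed_param[OF assms] ..
  show ?thesis
    using path_value_le[OF constant_speed_param_admissible[OF q(1) \<gamma> assms]]
      path_len_le_lipschitz[OF constant_speed_param_lipschitz[OF \<gamma>]] q(2) by simp
qed

section \<open>Approximation by inscribed polygons\<close>

lemma inscribed_polygon_len_le:
  assumes "rectifiable \<gamma>" "K \<ge> 1"
  shows "polygon_len K (\<lambda>i. \<gamma> (real i / real K)) \<le> path_len \<gamma>"
  unfolding path_len_def
proof (rule cSup_upper)
  show "polygon_len K (\<lambda>i. \<gamma> (real i / real K)) \<in> partition_sums \<gamma>"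
    unfolding partition_sums_def polygon_len_lessThan
    by (rule CollectI, rule exI[of _ K], rule exI[of _ "\<lambda>i. real i / real K"])
      (use assms(2) in \<open>auto simp: divide_right_mono\<close>)
qed (use assms(1) in \<open>simp add: rectifiable_def\<close>)

text \<open>Once the mesh \<open>1 / K\<close> is below the modulus of uniform continuity for
  \<open>d\<close>, each point of the path is within \<open>d\<close> of a vertex. The threshold on
  \<open>K\<close> is the same for all angles.\<close>

lemma inscribed_polygon_support:
  assumes "path \<gamma>" "0 < d"
  shows "\<forall>\<^sub>F K in sequentially. \<forall>\<phi>.
    path_support \<gamma> \<phi> \<le> polygon_support K (\<lambda>i. \<gamma> (real i / real K)) \<phi> + d"
proof -
  have "uniformly_continuous_on {0..1} \<gamma>"
    using assms(1) by (intro compact_uniformly_continuous) (auto simp: path_def)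
  then obtain e where e: "0 < e"
    "\<And>p p'. p \<in> {0..1} \<Longrightarrow> p' \<in> {0..1} \<Longrightarrow> dist p p' < e \<Longrightarrow> dist (\<gamma> p) (\<gamma> p') < d"
    unfolding uniformly_continuous_on_def using assms(2) by metis
  have "\<forall>\<^sub>F K in sequentially. 1 / real K < e"
    using lim_1_over_n[where 'a = real] e(1) by (rule order_tendstoD)
  then show ?thesis
    using eventually_ge_at_top[of 1]
  proof eventually_elim
    case (elim K)
    show ?case
    proof (intro allI path_support_le)
      fix \<phi> p :: real assume p: "p \<in> {0..1}"
      \<comment> \<open>The last grid point at or before \<open>p\<close>.\<close>
      define i where "i = nat \<lfloor>p * real K\<rfloor>"
      have i: "real i \<le> p * real K" "p * real K < real i + 1"
        using p by (simp_all add: i_def)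
      have "p * real K \<le> real K" using p by (simp add: mult_left_le_one_le)
      then have iK: "i \<le> K" using i(1) by linarith
      have "real i / real K \<le> p" "p < real i / real K + 1 / real K"
        using i elim(2) by (simp_all add: field_simps)
      then have "dist p (real i / real K) < e" "real i / real K \<in> {0..1}"
        using elim iK p by (auto simp: dist_real_def)
      then have "dist (\<gamma> p) (\<gamma> (real i / real K)) < d" using e(2) p by blast
      then show "\<gamma> p \<bullet> dir \<phi> \<le> polygon_support K (\<lambda>i. \<gamma> (real i / real K)) \<phi> + d"
        using inner_dir_le_dist[of "\<gamma> p" \<phi> "\<gamma> (real i / real K)"]
          polygon_support_ge[OF iK, of "\<lambda>i. \<gamma> (real i / real K)" \<phi>] by simp
    qed
  qed
qed

text \<open>The constraint is imposed on one period only; \<open>F\<close> inherits the period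
  \<open>2 * pi\<close> from \<open>dir\<close>.\<close>

lemma satisfies_constraint_all:
  assumes "satisfies_constraint \<alpha> \<beta> (path_support \<gamma>)"
  shows "c \<le> F \<alpha> \<beta> (path_support \<gamma>) t"
proof -
  define n where "n = \<lfloor>t / (2 * pi)\<rfloor>"
  define t' where "t' = t - of_int n * (2 * pi)"
  have "of_int n \<le> t / (2 * pi)" "t / (2 * pi) < of_int n + 1"
    unfolding n_def by (auto simp: floor_correct)
  then have t': "t' \<in> {0..<2 * pi}" by (auto simp: t'_def field_simps)
  have per: "path_support \<gamma> (x + of_int n * (2 * pi)) = path_support \<gamma> x" for x
  proof -
    have "dir (x + of_int n * (2 * pi)) = dir x"
      using cos.plus_of_int[of x n] sin.plus_of_int[of x n] by (simp add: dir_def mult.commute)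
    then show ?thesis by (simp add: path_support_def)
  qed
  have "F \<alpha> \<beta> (path_support \<gamma>) t = F \<alpha> \<beta> (path_support \<gamma>) t'"
    using per[of t'] per[of "t' + pi + \<alpha>"] per[of "t' + pi - \<beta>"]
    by (simp add: F_def t'_def algebra_simps)
  then show ?thesis using assms t' by (simp add: satisfies_constraint_def c_def)
qed

lemma polygon_value_tendsto: "polygon_value \<alpha> \<beta> \<longlonglongrightarrow> path_value \<alpha> \<beta>"
proof (rule order_tendstoI)
  fix a assume "a < path_value \<alpha> \<beta>"
  then show "\<forall>\<^sub>F K in sequentially. a < polygon_value \<alpha> \<beta> K"
    using path_value_le_polygon_value by (auto intro!: eventually_sequentiallyI[of 1] intro: less_le_trans)
next
  fix a assume a: "path_value \<alpha> \<beta> < a"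
  have "{path_len \<gamma> | \<gamma>. admissible_path \<alpha> \<beta> \<gamma>} \<noteq> {}"
    using ex_admissible_polygon[of 1] ex_constant_speed_param[of 1] constant_speed_param_admissible
    by blast
  from cInf_lessD[OF this a[unfolded path_value_def]]
  obtain \<gamma> where \<gamma>: "admissible_path \<alpha> \<beta> \<gamma>" and len: "path_len \<gamma> < a"
    by blast
  have len0: "0 \<le> path_len \<gamma>" using \<gamma> by (simp add: admissible_path_def path_len_nonneg)
  \<comment> \<open>The tolerance is chosen so that the dilation \<open>l\<close> below equals
    \<open>2 * a / (a + path_len \<gamma>)\<close>. Since \<open>path_len \<gamma> < a\<close>, this
    gives \<open>l * path_len \<gamma> < a\<close>.\<close>
  define d where "d = c * (a - path_len \<gamma>) / (2 * a * W)"
  have "W * d = c * (a - path_len \<gamma>) / (2 * a)"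
    using W_pos by (simp add: d_def)
  then have Wd: "c - W * d = c * (a + path_len \<gamma>) / (2 * a)"
    using len len0 by (simp add: field_simps)
  have "0 < c - W * d" unfolding Wd using len len0 c_pos by simp
  then have d: "0 < d" "W * d < c" using len len0 c_pos W_pos by (simp_all add: d_def)
  define l where "l = c / (c - W * d)"
  have l: "0 < l" "l * (c - W * d) = c" using d(2) c_pos by (simp_all add: l_def)
  have "path \<gamma>" using \<gamma> by (simp add: admissible_path_def)
  from inscribed_polygon_support[OF this d(1)] eventually_ge_at_top[of 1]
  show "\<forall>\<^sub>F K in sequentially. polygon_value \<alpha> \<beta> K < a"
  proof eventually_elim
    case (elim K)
    define q where "q = (\<lambda>i. \<gamma> (real i / real K))"
    have "c \<le> l * F \<alpha> \<beta> (polygon_support K q) t" for t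
    proof -
      \<comment> \<open>The inscribed polygon violates the constraint by at most
        \<open>W * d\<close>, and \<open>l\<close> compensates exactly that.\<close>
      have "c \<le> F \<alpha> \<beta> (polygon_support K q) t + W * d"
        using satisfies_constraint_all[of \<gamma> t] \<gamma> F_le_add[of "path_support \<gamma>" "polygon_support K q" d t] elim(1)
        by (simp add: admissible_path_def q_def)
      then have "l * (c - W * d) \<le> l * F \<alpha> \<beta> (polygon_support K q) t"
        using l(1) by (intro mult_left_mono) auto
      then show ?thesis using l(2) by simp
    qed
    then have "admissible_polygon \<alpha> \<beta> K (\<lambda>i. l *\<^sub>R q i)"
      using l(1) \<gamma> by (intro admissible_polygon_scaleR) (auto simp: q_def admissible_path_def)
    then have "polygon_value \<alpha> \<beta> K \<le> l * polygon_len K q"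
      using polygon_value_le polygon_len_scaleR[of l K q] l(1) by fastforce
    also have "\<dots> \<le> l * path_len \<gamma>"
      using l(1) \<gamma> inscribed_polygon_len_le[OF _ elim(2), of \<gamma>]
      by (intro mult_left_mono) (auto simp: q_def admissible_path_def)
    also have "\<dots> < a" 
    proof -
      have "c * path_len \<gamma> < c * ((a + path_len \<gamma>) / 2)"
        using len c_pos by (intro mult_strict_left_mono) auto
      also have "\<dots> = a * (c - W * d)" unfolding Wd using len len0 by simp
      finally have "c * path_len \<gamma> < a * (c - W * d)" .
      then show ?thesis using d(2) by (simp add: l_def pos_divide_less_eq)
    qed
    finally show ?case .
  qed
qed

section \<open>Limits of asymptotically optimal polygons\<close>

text \<open>The constraint is closed because \<open>F\<close> depends continuously on the path in
  the sup distance. Rectifiability is assumed, since uniform convergence alone does not pass it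
  on.\<close>

lemma admissible_path_uniform_limit:
  assumes lim: "uniform_limit {0..1} P \<gamma> sequentially"
    and adm: "\<And>n. admissible_path \<alpha> \<beta> (P n)"
    and "rectifiable \<gamma>"
  shows "admissible_path \<alpha> \<beta> \<gamma>"
proof -
  have path: "path (P n)" for n using adm by (simp add: admissible_path_def)
  have "(\<lambda>n. P n 0) \<longlonglongrightarrow> \<gamma> 0" using lim by (rule tendsto_uniform_limitI) simp
  moreover have "P n 0 = 0" for n using adm by (simp add: admissible_path_def)
  ultimately have "\<gamma> 0 = 0" by (simp add: LIMSEQ_const_iff)
  moreover have path\<gamma>: "path \<gamma>"
    using uniform_limit_theorem[OF _ lim] path by (simp add: path_def)
  moreover have "c \<le> F \<alpha> \<beta> (path_support \<gamma>) t" for t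
  proof (rule field_le_epsilon)
    fix e :: real assume "0 < e"
    \<comment> \<open>The tolerance \<open>e / W\<close> cancels the Lipschitz constant
      \<open>W\<close> of \<open>F\<close>, so a single good \<open>n\<close> suffices for each
      \<open>e\<close>.\<close>
    then have "\<forall>\<^sub>F n in sequentially. \<forall>p\<in>{0..1}. dist (P n p) (\<gamma> p) < e / W"
      using W_pos by (intro uniform_limitD[OF lim]) simp
    from eventually_happens'[OF trivial_limit_sequentially this]
    obtain n where "\<forall>p\<in>{0..1}. dist (P n p) (\<gamma> p) < e / W" ..
    then have "dist (P n p) (\<gamma> p) \<le> e / W" if "p \<in> {0..1}" for p
      using that by (simp add: less_imp_le)
    from F_le_add[OF path_support_le_add[OF path\<gamma> this]]
    have "F \<alpha> \<beta> (path_support (P n)) t \<le> F \<alpha> \<beta> (path_support \<gamma>) t + e"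
      using W_pos by simp
    then show "c \<le> F \<alpha> \<beta> (path_support \<gamma>) t + e"
      using satisfies_constraint_all[of "P n" t] adm[of n] by (simp add: admissible_path_def)
  qed
  ultimately show ?thesis
    using assms(3) by (simp add: admissible_path_def satisfies_constraint_def c_def)
qed

lemma asymptotically_optimal_subsequence:
  fixes q :: "nat \<Rightarrow> nat \<Rightarrow> real ^ 2" and P :: "nat \<Rightarrow> real \<Rightarrow> real ^ 2"
  assumes adm: "\<And>K. K \<ge> 1 \<Longrightarrow> admissible_polygon \<alpha> \<beta> K (q K)"
    and bound: "\<And>K. K \<ge> 1 \<Longrightarrow> polygon_len K (q K) \<le> B"
    and opt: "(\<lambda>K. polygon_len K (q K) - polygon_value \<alpha> \<beta> K) \<longlonglongrightarrow> 0"
    and param: "\<And>K. K \<ge> 1 \<Longrightarrow> constant_speed_param K (q K) (P K)"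
  obtains r \<gamma> where "strict_mono r" "\<And>n. r n \<ge> 1"
    "uniform_limit {0..1} (\<lambda>n. P (r n)) \<gamma> sequentially"
    "admissible_path \<alpha> \<beta> \<gamma>" "path_len \<gamma> = path_value \<alpha> \<beta>"
proof -
  have B: "0 \<le> B" using bound[of 1] polygon_len_nonneg[of 1 "q 1"] by simp
  have len: "(\<lambda>K. polygon_len K (q K)) \<longlonglongrightarrow> path_value \<alpha> \<beta>"
    using tendsto_add[OF opt polygon_value_tendsto] by simp
  have lip: "(polygon_len K (q K))-lipschitz_on {0..1} (P K)" if "K \<ge> 1" for K
    by (rule constant_speed_param_lipschitz[OF param[OF that]])
  have P_adm: "admissible_path \<alpha> \<beta> (P K)" if "K \<ge> 1" for K
    by (rule constant_speed_param_admissible[OF adm param]) (fact that)+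
  \<comment> \<open>The shift by \<open>Suc\<close> turns hypotheses for \<open>K \<ge> 1\<close>
    into statements about a full sequence, as Arzela-Ascoli expects.\<close>
  have lipB: "norm (P (Suc n) x - P (Suc n) y) \<le> B * norm (x - y)"
    if "x \<in> {0..1}" "y \<in> {0..1}" for n x y
    using lipschitz_onD[OF lipschitz_on_le[OF lip bound] that, of "Suc n"] by (simp add: dist_norm)
  have bdd: "norm (P (Suc n) x) \<le> B" if "x \<in> {0..1}" for n x
  proof -
    have "norm (P (Suc n) x - P (Suc n) 0) \<le> B * norm (x - 0)" by (rule lipB) (use that in auto)
    also have "\<dots> \<le> B" using that B by (simp add: mult_left_le)
    finally show ?thesis using P_adm[of "Suc n"] by (simp add: admissible_path_def)
  qed
  have equi: "\<exists>d>0. \<forall>n y. y \<in> {0..1} \<and> norm (x - y) < d \<longrightarrow> norm (P (Suc n) x - P (Suc n) y) < e"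
    if x: "x \<in> {0..1}" and e: "0 < e" for x e
  proof (intro exI conjI allI impI)
    \<comment> \<open>\<open>B + 1\<close> rather than \<open>B\<close> covers the case
      \<open>B = 0\<close>.\<close>
    show "0 < e / (B + 1)" using e B by simp
    fix n y assume y: "y \<in> {0..1} \<and> norm (x - y) < e / (B + 1)"
    have "norm (P (Suc n) x - P (Suc n) y) \<le> B * norm (x - y)" using lipB x y by blast
    also have "\<dots> \<le> (B + 1) * norm (x - y)" by (simp add: distrib_right)
    also have "\<dots> < e" using y B by (simp add: pos_less_divide_eq mult.commute)
    finally show "norm (P (Suc n) x - P (Suc n) y) < e" .
  qed
  obtain \<gamma> and k :: "nat \<Rightarrow> nat" where k: "strict_mono k"
    and conv: "\<And>e. 0 < e \<Longrightarrow> \<exists>N. \<forall>n x. N \<le> n \<and> x \<in> {0..1} \<longrightarrow> norm (P (Suc (k n)) x - \<gamma> x) < e"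
    using Arzela_Ascoli[of "{0..1}" "\<lambda>n. P (Suc n)" B] bdd equi by (metis compact_Icc)
  define r where "r = (\<lambda>n. Suc (k n))"
  have r: "strict_mono r" "\<And>n. r n \<ge> 1" using k by (auto simp: r_def strict_mono_def)
  have lim: "uniform_limit {0..1} (\<lambda>n. P (r n)) \<gamma> sequentially"
    unfolding uniform_limit_sequentially_iff r_def dist_norm using conv by meson
  have lim_len: "(\<lambda>n. polygon_len (r n) (q (r n))) \<longlonglongrightarrow> path_value \<alpha> \<beta>"
    using LIMSEQ_subseq_LIMSEQ[OF len r(1)] by (simp add: o_def)
  \<comment> \<open>Semicontinuity of length appears in Lipschitz form: the Lipschitz constants of
    the \<open>P (r n)\<close> are the polygon lengths, which tend to the optimal value, and the
    inequality survives the pointwise limit.\<close>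
  have "(path_value \<alpha> \<beta>)-lipschitz_on {0..1} \<gamma>"
  proof (rule lipschitz_onI)
    fix x y :: real assume xy: "x \<in> {0..1}" "y \<in> {0..1}"
    show "dist (\<gamma> x) (\<gamma> y) \<le> path_value \<alpha> \<beta> * dist x y"
    proof (rule LIMSEQ_le)
      show "(\<lambda>n. dist (P (r n) x) (P (r n) y)) \<longlonglongrightarrow> dist (\<gamma> x) (\<gamma> y)"
        using xy by (intro tendsto_dist tendsto_uniform_limitI[OF lim])
      show "(\<lambda>n. polygon_len (r n) (q (r n)) * dist x y) \<longlonglongrightarrow> path_value \<alpha> \<beta> * dist x y"
        by (intro tendsto_mult_right lim_len)
      show "\<exists>N. \<forall>n\<ge>N. dist (P (r n) x) (P (r n) y) \<le> polygon_len (r n) (q (r n)) * dist x y"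
        using lipschitz_onD[OF lip[OF r(2)] xy] by blast
    qed
  next
    show "0 \<le> path_value \<alpha> \<beta>"
      using lim_len by (rule LIMSEQ_le_const) (auto simp: polygon_len_nonneg)
  qed
  note lip\<gamma> = this
  have adm\<gamma>: "admissible_path \<alpha> \<beta> \<gamma>"
    by (rule admissible_path_uniform_limit[OF lim P_adm[OF r(2)] lipschitz_imp_rectifiable[OF lip\<gamma>]])
  \<comment> \<open>The Lipschitz constant bounds the length from above, and admissibility bounds it
    from below by the infimum.\<close>
  moreover have "path_len \<gamma> = path_value \<alpha> \<beta>"
    using path_len_le_lipschitz[OF lip\<gamma>] path_value_le[OF adm\<gamma>] by simp
  ultimately show thesis using that r lim by blast
qed

end

theorem theorem6:
  fixes \<alpha> \<beta> :: real
  assumes "\<alpha> > 0" and "\<beta> > 0" and "\<alpha> + \<beta> < pi"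
  shows "(\<forall>K\<ge>1. \<exists>q. admissible_polygon \<alpha> \<beta> K q \<and> polygon_len K q = polygon_value \<alpha> \<beta> K) \<and>
    (\<lambda>K. polygon_value \<alpha> \<beta> K) \<longlonglongrightarrow> path_value \<alpha> \<beta> \<and>
    (\<forall>(q :: nat \<Rightarrow> nat \<Rightarrow> real ^ 2) (P :: nat \<Rightarrow> real \<Rightarrow> real ^ 2).
       (\<forall>K\<ge>1. admissible_polygon \<alpha> \<beta> K (q K)) \<and>
       (\<exists>B. \<forall>K\<ge>1. polygon_len K (q K) \<le> B) \<and>
       (\<lambda>K. polygon_len K (q K) - polygon_value \<alpha> \<beta> K) \<longlonglongrightarrow> 0 \<and>
       (\<forall>K\<ge>1. constant_speed_param K (q K) (P K))
       \<longrightarrow> (\<exists>(r :: nat \<Rightarrow> nat) \<gamma>.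
              strict_mono r \<and> (\<forall>n. r n \<ge> 1) \<and>
              uniform_limit {0..1} (\<lambda>n. P (r n)) \<gamma> sequentially \<and>
              admissible_path \<alpha> \<beta> \<gamma> \<and> path_len \<gamma> = path_value \<alpha> \<beta>))"
proof -
  interpret triangle_angles \<alpha> \<beta> using assms by unfold_locales
  show ?thesis
  proof (intro conjI allI impI)
    fix K :: nat assume "K \<ge> 1"
    then show "\<exists>q. admissible_polygon \<alpha> \<beta> K q \<and> polygon_len K q = polygon_value \<alpha> \<beta> K"
      by (meson polygon_value_attained)
  next
    show "polygon_value \<alpha> \<beta> \<longlonglongrightarrow> path_value \<alpha> \<beta>" by (rule polygon_value_tendsto)
  next
    fix q :: "nat \<Rightarrow> nat \<Rightarrow> real ^ 2" and P :: "nat \<Rightarrow> real \<Rightarrow> real ^ 2"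
    assume asm: "(\<forall>K\<ge>1. admissible_polygon \<alpha> \<beta> K (q K)) \<and>
       (\<exists>B. \<forall>K\<ge>1. polygon_len K (q K) \<le> B) \<and>
       (\<lambda>K. polygon_len K (q K) - polygon_value \<alpha> \<beta> K) \<longlonglongrightarrow> 0 \<and>
       (\<forall>K\<ge>1. constant_speed_param K (q K) (P K))"
    then obtain B where B: "\<And>K. K \<ge> 1 \<Longrightarrow> polygon_len K (q K) \<le> B" by blast
    obtain r \<gamma> where "strict_mono r" "\<And>n. r n \<ge> 1"
      "uniform_limit {0..1} (\<lambda>n. P (r n)) \<gamma> sequentially"
      "admissible_path \<alpha> \<beta> \<gamma>" "path_len \<gamma> = path_value \<alpha> \<beta>"
      by (rule asymptotically_optimal_subsequence[of q B P]) (use asm B in blast)+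
    then show "\<exists>(r :: nat \<Rightarrow> nat) \<gamma>.
              strict_mono r \<and> (\<forall>n. r n \<ge> 1) \<and>
              uniform_limit {0..1} (\<lambda>n. P (r n)) \<gamma> sequentially \<and>
              admissible_path \<alpha> \<beta> \<gamma> \<and> path_len \<gamma> = path_value \<alpha> \<beta>"
      by blast
  qed
qed

end
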